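(* Assume that each $f_i:\mathbb{R}^n\to\mathbb{R}$, $i=1,\dots,N$, is continuously differentiable and strongly convex with $l$-Lipschitz continuous gradient; that the problem $\min \sum_{i=1}^N f_i(x_i)$ subject to $\sum_{i=1}^N x_i=\sum_{i=1}^N d_i$ has a finite optimal allocation $X^*$; and that the attack signals $u_i^a(t),\lambda_i^a(t),z_i^a(t)\in\mathbb{R}^n$ and their time derivatives are bounded on $[0,\infty)$ for all $i$. Then the distributed resource allocation algorithm under false data injection attacks, $$\begin{aligned}\dot x_i&=-\nabla f_i(x_i)-\lambda_i+\kappa_{i1},\\ \dot\lambda_i&=-\sum_{j=1}^N a_{ij}(\lambda_i-\lambda_j)-\sum_{j=1}^N a_{ij}(z_i-z_j)+x_i-d_i+\kappa_{i2},\\ \dot z_i&=\sum_{j=1}^N a_{ij}(\lambda_i-\lambda_j)+\kappa_{i3},\end{aligned}\qquad i=1,\dots,N,$$ converges to a neighborhood of $X^*$ whose size depends on the upper bound of the attacks. That is, there is a function $r:[0,\infty)\to[0,\infty)$, depending only on the problem data ($f_i$, $d_i$, $a_{ij}$, $N$, $n$) and not on the attack signals or the initial condition, such that whenever $\|u_i^a(t)\|,\|\lambda_i^a(t)\|,\|z_i^a(t)\|\le D$ for all $i$ and all $t\ge 0$, every solution satisfies $$\limsup_{t\to\infty}\|X(t)-X^*\|\le r(D).$$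
   Context: $N$ agents have decisions $x_i\in\mathbb{R}^n$, cost functions $f_i$ and resource data $d_i\in\mathbb{R}^n$; $X=\mathrm{col}(x_1,\dots,x_N)$ is the stacked vector and $\lambda_i,z_i\in\mathbb{R}^n$ are auxiliary states. The agents communicate over a fixed undirected connected graph on $\{1,\dots,N\}$ with symmetric edge weights $a_{ij}=a_{ji}\ge 0$ ($a_{ij}>0$ exactly when $(i,j)$ is an edge). The attacker adds $u_i^a(t)$ to the control input of agent $i$, and adds $\lambda_i^a(t)$ and $z_i^a(t)$ to the information $\lambda_i$ and $z_i$ exchanged over the network, so that $$\kappa_{i1}=u_i^a,\qquad \kappa_{i2}=-\sum_{j=1}^N a_{ij}(\lambda_i^a-\lambda_j^a)-\sum_{j=1}^N a_{ij}(z_i^a-z_j^a),\qquad \kappa_{i3}=\sum_{j=1}^N a_{ij}(\lambda_i^a-\lambda_j^a).$$ $\|\cdot\|$ is the Euclidean norm. *)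

theory Defs
  imports "HOL-Analysis.Analysis"
begin

definition strongly_convex :: "('a::real_normed_vector \<Rightarrow> real) \<Rightarrow> bool" where
  "strongly_convex f \<longleftrightarrow>
     (\<exists>\<mu>>0. \<forall>x y. \<forall>t\<in>{0..1}.
        f ((1 - t) *\<^sub>R x + t *\<^sub>R y)
          \<le> (1 - t) * f x + t * f y - \<mu> / 2 * t * (1 - t) * (norm (x - y))\<^sup>2)"

definition continuously_differentiable_with_gradient ::
    "('a::real_inner \<Rightarrow> real) \<Rightarrow> ('a \<Rightarrow> 'a) \<Rightarrow> bool" where
  "continuously_differentiable_with_gradient f g \<longleftrightarrow>
     (\<forall>x. GDERIV f x :> g x) \<and> continuous_on UNIV g"

(* Self-loops are not excluded: all graph terms of the algorithm are differences
   between agents i and j, so the weights a i i are irrelevant. *)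
definition undirected_connected :: "('m \<times> 'm) set \<Rightarrow> bool" where
  "undirected_connected E \<longleftrightarrow> sym E \<and> (\<forall>i j. (i, j) \<in> E\<^sup>*)"

definition symmetric_edge_weights :: "('m \<times> 'm) set \<Rightarrow> ('m \<Rightarrow> 'm \<Rightarrow> real) \<Rightarrow> bool" where
  "symmetric_edge_weights E a \<longleftrightarrow>
     (\<forall>i j. a i j = a j i \<and> 0 \<le> a i j \<and> (0 < a i j \<longleftrightarrow> (i, j) \<in> E))"

(* A stacked vector col(x_1, ..., x_N) of decisions in R^n has type real ^ 'n ^ 'm, where
   'm indexes the agents; its norm is the Euclidean norm of the stacked vector. *)

definition feasible_allocation ::
    "('m \<Rightarrow> real ^ 'n) \<Rightarrow> (real ^ 'n) ^ 'm \<Rightarrow> bool" where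
  "feasible_allocation d X \<longleftrightarrow> (\<Sum>i\<in>UNIV. X $ i) = (\<Sum>i\<in>UNIV. d i)"

definition optimal_allocation ::
    "('m \<Rightarrow> real ^ 'n \<Rightarrow> real) \<Rightarrow> ('m \<Rightarrow> real ^ 'n) \<Rightarrow> (real ^ 'n) ^ 'm \<Rightarrow> bool" where
  "optimal_allocation f d X \<longleftrightarrow> feasible_allocation d X \<and>
     (\<forall>Y. feasible_allocation d Y \<longrightarrow> (\<Sum>i\<in>UNIV. f i (X $ i)) \<le> (\<Sum>i\<in>UNIV. f i (Y $ i)))"

(* The signal and its derivative (one-sided at 0) are bounded on the half-line. *)
definition bounded_signal :: "(real \<Rightarrow> real ^ 'n) \<Rightarrow> bool" where
  "bounded_signal s \<longleftrightarrow>
     bounded (s ` {0..}) \<and> s differentiable_on {0..} \<and>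
     bounded ((\<lambda>t. vector_derivative s (at t within {0..})) ` {0..})"

(* ua, la, za are the attacks on the control inputs and on the exchanged lambda and z. *)
definition kappa1 :: "(real \<Rightarrow> (real ^ 'n) ^ 'm) \<Rightarrow> 'm \<Rightarrow> real \<Rightarrow> real ^ 'n" where
  "kappa1 ua i t = ua t $ i"

definition kappa2 :: "('m \<Rightarrow> 'm \<Rightarrow> real) \<Rightarrow> (real \<Rightarrow> (real ^ 'n) ^ 'm) \<Rightarrow>
    (real \<Rightarrow> (real ^ 'n) ^ 'm) \<Rightarrow> 'm \<Rightarrow> real \<Rightarrow> real ^ 'n" where
  "kappa2 a la za i t =
     - (\<Sum>j\<in>UNIV. a i j *\<^sub>R (la t $ i - la t $ j)) - (\<Sum>j\<in>UNIV. a i j *\<^sub>R (za t $ i - za t $ j))"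

definition kappa3 :: "('m \<Rightarrow> 'm \<Rightarrow> real) \<Rightarrow> (real \<Rightarrow> (real ^ 'n) ^ 'm) \<Rightarrow>
    'm \<Rightarrow> real \<Rightarrow> real ^ 'n" where
  "kappa3 a la i t = (\<Sum>j\<in>UNIV. a i j *\<^sub>R (la t $ i - la t $ j))"

definition attacked_solution ::
    "('m \<Rightarrow> real ^ 'n \<Rightarrow> real ^ 'n) \<Rightarrow> ('m \<Rightarrow> real ^ 'n) \<Rightarrow> ('m \<Rightarrow> 'm \<Rightarrow> real) \<Rightarrow>
     (real \<Rightarrow> (real ^ 'n) ^ 'm) \<Rightarrow> (real \<Rightarrow> (real ^ 'n) ^ 'm) \<Rightarrow> (real \<Rightarrow> (real ^ 'n) ^ 'm) \<Rightarrow>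
     (real \<Rightarrow> (real ^ 'n) ^ 'm) \<Rightarrow> (real \<Rightarrow> (real ^ 'n) ^ 'm) \<Rightarrow> (real \<Rightarrow> (real ^ 'n) ^ 'm) \<Rightarrow> bool" where
  "attacked_solution g d a ua la za X L Z \<longleftrightarrow>
     (\<forall>t\<ge>0. \<forall>i.
        ((\<lambda>s. X s $ i) has_vector_derivative
           (- g i (X t $ i) - L t $ i + kappa1 ua i t)) (at t within {0..}) \<and>
        ((\<lambda>s. L s $ i) has_vector_derivative
           (- (\<Sum>j\<in>UNIV. a i j *\<^sub>R (L t $ i - L t $ j))
            - (\<Sum>j\<in>UNIV. a i j *\<^sub>R (Z t $ i - Z t $ j))
            + X t $ i - d i + kappa2 a la za i t)) (at t within {0..}) \<and>
        ((\<lambda>s. Z s $ i) has_vector_derivative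
           ((\<Sum>j\<in>UNIV. a i j *\<^sub>R (L t $ i - L t $ j)) + kappa3 a la i t)) (at t within {0..}))"

end

theory Submission
  imports Defs
begin

text \<open>Shift the states by a KKT point \<open>(X*, \<lambda>*, z*)\<close> and project the shifted \<open>z\<close> onto vectors with zero
  sum, whose complement is invisible to the Laplacian \<open>A\<close> and the rest of the dynamics. The error
  \<open>(x, y, z)\<close> obeys a saddle flow with strongly monotone gradient part, perturbed by signals that are
  bounded by a multiple of \<open>D\<close>. For suitable small \<open>\<epsilon>, \<delta>\<close> the function
  \<open>V = (|x|^2 + |y|^2 + |z|^2) / 2 + \<epsilon> <x, y> + \<epsilon> \<delta> <y, z>\<close>
  satisfies \<open>V' \<le> - \<alpha> V + C D^2\<close>, because \<open>A\<close> is coercive on zero-sum vectors of a connected graph;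
  so \<open>|x|^2\<close> is eventually of order \<open>D^2\<close>.\<close>


section \<open>Scalar estimates: Young's inequality and a Gronwall bound\<close>

text \<open>Complete the square. The weight \<open>e\<close> is free, so a cross term can be charged
  to a prescribed fraction of an available \<open>v\<^sup>2\<close>, at the price of a large
  multiple of \<open>u\<^sup>2\<close>.\<close>

lemma Young_ineq:
  fixes u v e :: real
  assumes "e > 0"
  shows "p * u * v \<le> e * v\<^sup>2 + p\<^sup>2 / (4 * e) * u\<^sup>2"
proof -
  have "0 \<le> (2 * e * v - p * u)\<^sup>2 / (4 * e)"
    using assms by simp
  also have "\<dots> = e * v\<^sup>2 + p\<^sup>2 / (4 * e) * u\<^sup>2 - p * u * v"
    using assms by (simp add: field_simps power2_eq_square)
  finally show ?thesis by simp
qed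

text \<open>The integrating factor \<open>exp (\<alpha> * s)\<close> makes the shifted function
  \<open>W\<close> nonincreasing. Derivatives are one-sided at 0, as for the solutions of the
  algorithm.\<close>

lemma differential_inequality_exp_bound:
  fixes V V' :: "real \<Rightarrow> real"
  assumes deriv: "\<And>t. t \<ge> 0 \<Longrightarrow> (V has_real_derivative V' t) (at t within {0..})"
    and bound: "\<And>t. t \<ge> 0 \<Longrightarrow> V' t \<le> - \<alpha> * V t + C"
    and \<alpha>: "\<alpha> > 0" and t: "t \<ge> 0"
  shows "V t \<le> (V 0 - C / \<alpha>) * exp (- \<alpha> * t) + C / \<alpha>"
proof -
  define W where "W = (\<lambda>s. (V s - C / \<alpha>) * exp (\<alpha> * s))"
  have W: "(W has_real_derivative (V' s + \<alpha> * V s - C) * exp (\<alpha> * s)) (at s within {0..})"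
    if "s \<ge> 0" for s
    unfolding W_def using \<alpha>
    by (auto intro!: derivative_eq_intros deriv that simp: field_simps)
  have "W t \<le> W 0"
  proof (rule DERIV_nonpos_imp_decreasing_open[OF t])
    show "continuous_on {0..t} W"
      unfolding continuous_on_eq_continuous_within
      by (metis W DERIV_continuous atLeastAtMost_iff atLeast_iff
          continuous_within_subset subsetI)
    fix s assume s: "0 < s" "s < t"
    \<comment> \<open>At 0 only continuity of \<open>W\<close> is required; at interior points the
      one-sided derivative is a full one.\<close>
    have "at s within {0..} = at s"
      using s by (intro at_within_interior) simp
    with W[of s] s have "(W has_real_derivative (V' s + \<alpha> * V s - C) * exp (\<alpha> * s)) (at s)"
      by simp
    moreover have "(V' s + \<alpha> * V s - C) * exp (\<alpha> * s) \<le> 0"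
      using bound[of s] s by (intro mult_nonpos_nonneg) simp_all
    ultimately show "\<exists>y. (W has_real_derivative y) (at s) \<and> y \<le> 0"
      by blast
  qed
  then have "W t * exp (- \<alpha> * t) \<le> W 0 * exp (- \<alpha> * t)"
    by (rule mult_right_mono) simp
  moreover have "W t * exp (- \<alpha> * t) = V t - C / \<alpha>"
    by (simp add: W_def mult.assoc flip: exp_add)
  moreover have "W 0 * exp (- \<alpha> * t) = (V 0 - C / \<alpha>) * exp (- \<alpha> * t)"
    by (simp add: W_def)
  ultimately show ?thesis by linarith
qed

section \<open>Gradients, strong convexity and the optimality condition\<close>

lemma GDERIV_line_derivative:
  assumes "GDERIV f x :> g"
  shows "((\<lambda>t. f (x + t *\<^sub>R v)) has_real_derivative inner v g) (at 0)"
proof -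
  have line: "((\<lambda>t. x + t *\<^sub>R v) has_derivative (\<lambda>t. t *\<^sub>R v)) (at 0)"
    by (auto intro!: derivative_eq_intros)
  have "(f has_derivative (\<lambda>u. inner u g)) (at (x + 0 *\<^sub>R v))"
    using assms by (simp add: gderiv_def)
  from has_derivative_compose[where f = "\<lambda>t. x + t *\<^sub>R v" and x = "0::real", OF line this] show ?thesis
    by (simp add: has_field_derivative_def mult_commute_abs)
qed

text \<open>Subtract \<open>f x\<close> from the convexity inequality on the segment from
  \<open>x\<close> to \<open>y\<close>, divide by \<open>t\<close> and let \<open>t\<close> decrease
  to 0: the difference quotient tends to the directional derivative and the factor
  \<open>1 - t\<close> to 1.\<close>

lemma gradient_strongly_convex_inequality:
  assumes grad: "GDERIV f x :> g"
    and conv: "\<And>t. t \<in> {0..1} \<Longrightarrow> f ((1 - t) *\<^sub>R x + t *\<^sub>R y)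
          \<le> (1 - t) * f x + t * f y - \<mu> / 2 * t * (1 - t) * (norm (x - y))\<^sup>2"
  shows "inner (y - x) g \<le> f y - f x - \<mu> / 2 * (norm (x - y))\<^sup>2"
proof -
  define h where "h = (\<lambda>t. f (x + t *\<^sub>R (y - x)))"
  have "(h has_real_derivative inner (y - x) g) (at 0)"
    unfolding h_def by (rule GDERIV_line_derivative[OF grad])
  then have "((\<lambda>t. (h t - h 0) / t) \<longlongrightarrow> inner (y - x) g) (at 0)"
    by (simp add: DERIV_def)
  then have lim: "((\<lambda>t. (h t - h 0) / t) \<longlongrightarrow> inner (y - x) g) (at_right 0)"
    by (rule filterlim_mono) (auto simp: at_within_le_at)
  have lim': "((\<lambda>t. f y - f x - \<mu> / 2 * (1 - t) * (norm (x - y))\<^sup>2)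
      \<longlongrightarrow> f y - f x - \<mu> / 2 * (1 - 0) * (norm (x - y))\<^sup>2) (at_right 0)"
    by (intro tendsto_intros)
  have "\<forall>\<^sub>F t in at_right (0::real). t \<in> {0<..<1}"
    by (rule eventually_at_right_real) simp
  then have "\<forall>\<^sub>F t in at_right 0.
      (h t - h 0) / t \<le> f y - f x - \<mu> / 2 * (1 - t) * (norm (x - y))\<^sup>2"
  proof eventually_elim
    case (elim t)
    have "x + t *\<^sub>R (y - x) = (1 - t) *\<^sub>R x + t *\<^sub>R y"
      by (simp add: algebra_simps)
    then have "h t - h 0 \<le> t * (f y - f x - \<mu> / 2 * (1 - t) * (norm (x - y))\<^sup>2)"
      using conv[of t] elim by (simp add: h_def algebra_simps)
    then show ?case using elim by (simp add: field_simps)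
  qed
  from tendsto_le[OF _ lim' lim this] show ?thesis by simp
qed

text \<open>Adding the first-order inequalities at \<open>x\<close> and at \<open>y\<close> cancels
  the function values, and the two halves of \<mu> add up.\<close>

lemma strongly_convex_gradient_strongly_monotone:
  assumes "strongly_convex f" and "\<And>x. GDERIV f x :> g x"
  shows "\<exists>\<mu>>0. \<forall>x y. \<mu> * (norm (x - y))\<^sup>2 \<le> inner (x - y) (g x - g y)"
proof -
  from assms(1) obtain \<mu> where \<mu>: "\<mu> > 0"
    and conv: "\<And>x y t. t \<in> {0..1} \<Longrightarrow> f ((1 - t) *\<^sub>R x + t *\<^sub>R y)
          \<le> (1 - t) * f x + t * f y - \<mu> / 2 * t * (1 - t) * (norm (x - y))\<^sup>2"
    unfolding strongly_convex_def by blast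
  have "\<mu> * (norm (x - y))\<^sup>2 \<le> inner (x - y) (g x - g y)" for x y
    using gradient_strongly_convex_inequality[OF assms(2)[of x], of y \<mu>, OF conv]
      gradient_strongly_convex_inequality[OF assms(2)[of y], of x \<mu>, OF conv]
    by (simp add: norm_minus_commute algebra_simps)
  with \<mu> show ?thesis by blast
qed

text \<open>This is the KKT stationarity condition. Moving resource from agent \<open>j\<close> to
  agent \<open>i\<close> keeps the allocation feasible, so the total cost has zero derivative at the
  optimum along that exchange.\<close>

lemma optimal_allocation_gradients_eq:
  fixes X :: "(real ^ 'n::finite) ^ 'm::finite"
  assumes opt: "optimal_allocation f d X"
    and grad: "\<And>i x. GDERIV (f i) x :> g i x"
  shows "g i (X $ i) = g j (X $ j)"
proof (cases "i = j")
  case False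
  \<comment> \<open>Exchanging the gradient difference itself makes the derivative of the total cost
    equal to \<open>inner v v\<close>.\<close>
  define v where "v = g i (X $ i) - g j (X $ j)"
  define w where "w = (\<lambda>k. (if k = i then v else 0) - (if k = j then v else 0))"
  define h where "h = (\<lambda>t. \<Sum>k\<in>UNIV. f k (X $ k + t *\<^sub>R w k))"
  have "(h has_real_derivative (\<Sum>k\<in>UNIV. inner (w k) (g k (X $ k)))) (at 0)"
    unfolding h_def by (intro DERIV_sum GDERIV_line_derivative grad)
  also have "(\<Sum>k\<in>UNIV. inner (w k) (g k (X $ k))) =
      (\<Sum>k\<in>UNIV. (if k = i then inner v (g k (X $ k)) else 0)
        - (if k = j then inner v (g k (X $ k)) else 0))"
    by (rule sum.cong) (auto simp: w_def inner_diff_left)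
  also have "\<dots> = inner v v"
    by (simp add: sum_subtractf v_def inner_diff_right)
  finally have "(h has_real_derivative inner v v) (at 0)" .
  moreover have "h 0 \<le> h t" for t
  proof -
    have "feasible_allocation d (\<chi> k. X $ k + t *\<^sub>R w k)"
      using opt
      by (simp add: optimal_allocation_def feasible_allocation_def sum.distrib
          scaleR_sum_right[symmetric] w_def sum_subtractf)
    with opt show ?thesis
      by (force simp: optimal_allocation_def h_def)
  qed
  ultimately have "inner v v = 0"
    by (intro DERIV_local_min[of h _ 0 1]) auto
  then show ?thesis by (simp add: v_def)
qed simp


section \<open>Lyapunov analysis of the perturbed saddle flow\<close>

text \<open>Here \<open>x\<close>, \<open>y\<close>, \<open>z\<close> stand for the norms of the
  error components and \<open>M\<close> for the disturbance bound; the left side is the estimate of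
  the derivative of the Lyapunov function. The weights are chosen in order: \<delta> so that the
  \<open>y\<^sup>2\<close> terms of the second cross term stay below the dissipation from the first,
  then \<epsilon> so that all \<open>x\<^sup>2\<close> terms stay below that of the
  gradient.\<close>

lemma lyapunov_weights_exist:
  fixes \<mu> c l k :: real
  assumes "\<mu> > 0" "c > 0" "l \<ge> 0" "k \<ge> 0"
  obtains \<epsilon> \<delta> \<omega> :: real where "0 < \<epsilon>" "\<epsilon> \<le> 1 / 4" "0 < \<delta>" "\<delta> \<le> 1" "0 < \<omega>"
    and "\<And>x y z M. \<lbrakk>0 \<le> x; 0 \<le> y; 0 \<le> z; 0 \<le> M\<rbrakk> \<Longrightarrow>
      - \<mu> * x\<^sup>2 + M * (x + y + z)
      + \<epsilon> * (l * x * y - y\<^sup>2 + M * y + k * x * y + k * x * z + x\<^sup>2 + M * x)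
      + \<epsilon> * \<delta> * (k * y * z - c * z\<^sup>2 + x * z + M * z + k * y\<^sup>2 + M * y)
      \<le> - \<omega> / 2 * (x\<^sup>2 + y\<^sup>2 + z\<^sup>2) + 27 / (2 * \<omega>) * M\<^sup>2"
proof -
  \<comment> \<open>The denominators \<open>k + 1\<close> and \<open>k\<^sup>2 + 1\<close> keep the
    quotients positive when \<open>k = 0\<close>.\<close>
  define \<delta> where "\<delta> = min 1 (min (1 / (4 * (k + 1))) (c / (4 * (k\<^sup>2 + 1))))"
  have pos: "0 < k\<^sup>2 + 1" "0 < k + 1"
    using assms by (simp_all add: add_nonneg_pos)
  have \<delta>: "0 < \<delta>" "\<delta> \<le> 1"
    using assms pos by (auto simp: \<delta>_def)
  have "\<delta> * (k + 1) \<le> 1 / (4 * (k + 1)) * (k + 1)"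
    using pos by (intro mult_right_mono) (auto simp: \<delta>_def)
  also have "\<dots> = 1 / 4"
    using pos by (simp add: field_simps)
  finally have \<delta>k: "\<delta> * k \<le> 1 / 4"
    using pos \<delta> by (simp add: algebra_simps)
  have "\<delta> * (k\<^sup>2 + 1) \<le> c / (4 * (k\<^sup>2 + 1)) * (k\<^sup>2 + 1)"
    using pos by (intro mult_right_mono) (auto simp: \<delta>_def)
  also have "\<dots> = c / 4"
    using pos by (simp add: field_simps)
  finally have "\<delta> * k\<^sup>2 \<le> c / 4"
    using pos \<delta> by (simp add: algebra_simps)
  then have \<delta>kc: "\<delta> * (k\<^sup>2 / c) \<le> 1 / 4"
    using assms by (simp add: field_simps)
  \<comment> \<open>\<open>Q\<close> collects the coefficients of
    \<open>\<epsilon> * x\<^sup>2\<close>: 1 occurs directly, and the other two come from applying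
    Young's inequality to the products \<open>x * y\<close> and \<open>x * z\<close>.\<close>
  define Q where "Q = 1 + (l + k)\<^sup>2 + (k + \<delta>)\<^sup>2 / (\<delta> * c)"
  have Q: "Q > 0"
    unfolding Q_def using assms \<delta> by (intro add_pos_nonneg) simp_all
  \<comment> \<open>The cap \<open>1 / 4\<close> later makes the Lyapunov function comparable to the
    sum of squares; the other bound spends at most half of \<mu>.\<close>
  define \<epsilon> where "\<epsilon> = min (1 / 4) (\<mu> / (2 * Q))"
  have \<epsilon>: "0 < \<epsilon>" "\<epsilon> \<le> 1 / 4"
    using assms Q by (auto simp: \<epsilon>_def)
  have "\<epsilon> * Q \<le> \<mu> / (2 * Q) * Q"
    using Q by (intro mult_right_mono) (auto simp: \<epsilon>_def)
  then have \<epsilon>Q: "\<epsilon> * Q \<le> \<mu> / 2"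
    using Q by simp
  \<comment> \<open>These are the dissipation rates left for \<open>x\<close>, \<open>y\<close> and
    \<open>z\<close> once all cross terms are absorbed.\<close>
  define \<omega> where "\<omega> = min (\<mu> / 2) (min (\<epsilon> / 4) (\<epsilon> * \<delta> * c / 2))"
  have \<omega>: "0 < \<omega>"
    using assms \<delta> \<epsilon> by (auto simp: \<omega>_def)
  have \<omega>': "\<omega> \<le> \<mu> / 2" "\<omega> \<le> \<epsilon> / 4" "\<omega> \<le> \<epsilon> * \<delta> * c / 2"
    by (auto simp: \<omega>_def)
  have \<epsilon>\<delta>: "0 < \<epsilon> * \<delta>" "\<epsilon> * \<delta> \<le> 1"
    using \<epsilon> \<delta> mult_mono[of \<epsilon> 1 \<delta> 1] by auto
  show ?thesis
  proof
    fix x y z M :: real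
    assume nn: "0 \<le> x" "0 \<le> y" "0 \<le> z" "0 \<le> M"
    \<comment> \<open>Budget: of the available \<open>\<epsilon> * y\<^sup>2\<close>, a quarter goes
      to \<open>x * y\<close> and, by the choice of \<delta>, at most half to the terms carrying
      \<delta>. Of \<open>\<epsilon> * \<delta> * c * z\<^sup>2\<close>, a quarter each goes to
      \<open>x * z\<close> and \<open>y * z\<close>.\<close>
    have xy: "\<epsilon> * ((l + k) * x * y) \<le> \<epsilon> * (1 / 4 * y\<^sup>2 + (l + k)\<^sup>2 * x\<^sup>2)"
      using Young_ineq[of "1/4" "l + k" x y] \<epsilon> by (intro mult_left_mono) auto
    have xz: "\<epsilon> * ((k + \<delta>) * x * z) \<le> \<epsilon> * (\<delta> * c / 4 * z\<^sup>2 + (k + \<delta>)\<^sup>2 / (\<delta> * c) * x\<^sup>2)"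
      using Young_ineq[of "\<delta> * c / 4" "k + \<delta>" x z] \<epsilon> \<delta> assms by (intro mult_left_mono) auto
    have yz: "\<epsilon> * \<delta> * (k * y * z) \<le> \<epsilon> * \<delta> * (c / 4 * z\<^sup>2 + k\<^sup>2 / c * y\<^sup>2)"
      using Young_ineq[of "c / 4" k y z] \<epsilon>\<delta> assms by (intro mult_left_mono) auto
    \<comment> \<open>Each norm meets \<open>M\<close> at most three times, always with weight at
      most 1. Half of the remaining rate absorbs these terms; the three remainders add up to the
      constant 27.\<close>
    have M: "3 * M * v \<le> \<omega> / 2 * v\<^sup>2 + 9 / (2 * \<omega>) * M\<^sup>2" for v
      using Young_ineq[of "\<omega> / 2" 3 M v] \<omega> by simp
    have "\<epsilon> * (M * (x + y)) \<le> 1 * (M * (x + y))"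
      using \<epsilon> nn by (intro mult_right_mono) auto
    moreover have "\<epsilon> * \<delta> * (M * (y + z)) \<le> 1 * (M * (y + z))"
      using \<epsilon>\<delta> nn by (intro mult_right_mono) auto
    moreover have "0 \<le> M * x" "0 \<le> M * z" using nn by auto
    ultimately have dist: "M * (x + y + z) + \<epsilon> * (M * (x + y)) + \<epsilon> * \<delta> * (M * (y + z))
        \<le> 3 * M * x + 3 * M * y + 3 * M * z"
      by (simp add: algebra_simps)
    have Y: "\<epsilon> * (\<delta> * k) * y\<^sup>2 + \<epsilon> * (\<delta> * (k\<^sup>2 / c)) * y\<^sup>2 \<le> \<epsilon> * (1 / 4) * y\<^sup>2 + \<epsilon> * (1 / 4) * y\<^sup>2"
      using \<delta>k \<delta>kc \<epsilon> by (intro add_mono mult_right_mono mult_left_mono) auto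
    have X: "\<epsilon> * Q * x\<^sup>2 \<le> \<mu> / 2 * x\<^sup>2"
      using \<epsilon>Q by (intro mult_right_mono) auto
    have W: "\<omega> * x\<^sup>2 \<le> \<mu> / 2 * x\<^sup>2" "\<omega> * y\<^sup>2 \<le> \<epsilon> / 4 * y\<^sup>2" "\<omega> * z\<^sup>2 \<le> \<epsilon> * \<delta> * c / 2 * z\<^sup>2"
      by (intro mult_right_mono \<omega>'; simp)+
    have "- \<mu> * x\<^sup>2 + M * (x + y + z)
      + \<epsilon> * (l * x * y - y\<^sup>2 + M * y + k * x * y + k * x * z + x\<^sup>2 + M * x)
      + \<epsilon> * \<delta> * (k * y * z - c * z\<^sup>2 + x * z + M * z + k * y\<^sup>2 + M * y)
      = - \<mu> * x\<^sup>2 + (M * (x + y + z) + \<epsilon> * (M * (x + y)) + \<epsilon> * \<delta> * (M * (y + z)))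
        + \<epsilon> * ((l + k) * x * y) - \<epsilon> * y\<^sup>2 + \<epsilon> * ((k + \<delta>) * x * z) + \<epsilon> * x\<^sup>2
        + \<epsilon> * \<delta> * (k * y * z) - \<epsilon> * \<delta> * c * z\<^sup>2 + \<epsilon> * (\<delta> * k) * y\<^sup>2"
      by (simp add: algebra_simps)
    also have "\<dots> \<le> - \<mu> * x\<^sup>2 + (3 * M * x + 3 * M * y + 3 * M * z)
        + \<epsilon> * (1 / 4 * y\<^sup>2 + (l + k)\<^sup>2 * x\<^sup>2) - \<epsilon> * y\<^sup>2
        + \<epsilon> * (\<delta> * c / 4 * z\<^sup>2 + (k + \<delta>)\<^sup>2 / (\<delta> * c) * x\<^sup>2) + \<epsilon> * x\<^sup>2
        + \<epsilon> * \<delta> * (c / 4 * z\<^sup>2 + k\<^sup>2 / c * y\<^sup>2) - \<epsilon> * \<delta> * c * z\<^sup>2 + \<epsilon> * (\<delta> * k) * y\<^sup>2"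
      using xy xz yz dist by linarith
    also have "\<dots> = - \<mu> * x\<^sup>2 + (3 * M * x + 3 * M * y + 3 * M * z) + \<epsilon> * Q * x\<^sup>2 - 3 / 4 * (\<epsilon> * y\<^sup>2)
        - \<epsilon> * \<delta> * c / 2 * z\<^sup>2 + (\<epsilon> * (\<delta> * k) * y\<^sup>2 + \<epsilon> * (\<delta> * (k\<^sup>2 / c)) * y\<^sup>2)"
      unfolding Q_def by (simp add: algebra_simps)
    also have "\<dots> \<le> - (\<omega> * x\<^sup>2) - \<omega> * y\<^sup>2 - \<omega> * z\<^sup>2 + (3 * M * x + 3 * M * y + 3 * M * z)"
      using X Y W by linarith
    also have "\<dots> \<le> - \<omega> / 2 * (x\<^sup>2 + y\<^sup>2 + z\<^sup>2) + 27 / (2 * \<omega>) * M\<^sup>2"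
    proof -
      have "27 / (2 * \<omega>) * M\<^sup>2 = 3 * (9 / (2 * \<omega>) * M\<^sup>2)"
        by simp
      with M[of x] M[of y] M[of z] show ?thesis
        by (simp add: distrib_left)
    qed
    finally show "- \<mu> * x\<^sup>2 + M * (x + y + z)
      + \<epsilon> * (l * x * y - y\<^sup>2 + M * y + k * x * y + k * x * z + x\<^sup>2 + M * x)
      + \<epsilon> * \<delta> * (k * y * z - c * z\<^sup>2 + x * z + M * z + k * y\<^sup>2 + M * y)
      \<le> - \<omega> / 2 * (x\<^sup>2 + y\<^sup>2 + z\<^sup>2) + 27 / (2 * \<omega>) * M\<^sup>2" .
  qed (use \<epsilon> \<delta> \<omega> in auto)
qed

text \<open>The unperturbed energy only dissipates the first component (and disagreement in the second);
  the cross terms of the Lyapunov function supply the missing dissipation of the other two.\<close>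

lemma perturbed_saddle_flow_bound:
  fixes A :: "'a::real_inner \<Rightarrow> 'a" and \<mu> c l k :: real
  assumes constants: "\<mu> > 0" "c > 0" "l \<ge> 0" "k \<ge> 0"
    and selfadjoint: "\<And>v w. inner (A v) w = inner v (A w)"
    and psd: "\<And>v. 0 \<le> inner v (A v)"
    and norm_A: "\<And>v. norm (A v) \<le> k * norm v"
  obtains \<alpha> K :: real where "\<alpha> > 0" "K \<ge> 0"
    and "\<And>x y z G p q s M. \<lbrakk>
      \<And>t. t \<ge> 0 \<Longrightarrow> (x has_vector_derivative - G t - y t + p t) (at t within {0..});
      \<And>t. t \<ge> 0 \<Longrightarrow> (y has_vector_derivative - A (y t) - A (z t) + x t + q t) (at t within {0..});
      \<And>t. t \<ge> 0 \<Longrightarrow> (z has_vector_derivative A (y t) + s t) (at t within {0..});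
      \<And>t. t \<ge> 0 \<Longrightarrow> \<mu> * (norm (x t))\<^sup>2 \<le> inner (x t) (G t);
      \<And>t. t \<ge> 0 \<Longrightarrow> norm (G t) \<le> l * norm (x t);
      \<And>t. t \<ge> 0 \<Longrightarrow> c * (norm (z t))\<^sup>2 \<le> inner (z t) (A (z t));
      \<And>t. t \<ge> 0 \<Longrightarrow> norm (p t) \<le> M \<and> norm (q t) \<le> M \<and> norm (s t) \<le> M\<rbrakk> \<Longrightarrow>
      \<exists>B. \<forall>t\<ge>0. (norm (x t))\<^sup>2 \<le> B * exp (- \<alpha> * t) + K * M\<^sup>2"
proof -
  obtain \<epsilon> \<delta> \<omega> :: real where \<epsilon>: "0 < \<epsilon>" "\<epsilon> \<le> 1 / 4" and \<delta>: "0 < \<delta>" "\<delta> \<le> 1" and \<omega>: "0 < \<omega>"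
    and est: "\<And>x y z M. \<lbrakk>0 \<le> x; 0 \<le> y; 0 \<le> z; 0 \<le> M\<rbrakk> \<Longrightarrow>
      - \<mu> * x\<^sup>2 + M * (x + y + z)
      + \<epsilon> * (l * x * y - y\<^sup>2 + M * y + k * x * y + k * x * z + x\<^sup>2 + M * x)
      + \<epsilon> * \<delta> * (k * y * z - c * z\<^sup>2 + x * z + M * z + k * y\<^sup>2 + M * y)
      \<le> - \<omega> / 2 * (x\<^sup>2 + y\<^sup>2 + z\<^sup>2) + 27 / (2 * \<omega>) * M\<^sup>2"
    using lyapunov_weights_exist[OF constants] by metis
  show ?thesis
  proof
    \<comment> \<open>The second constant is the ratio of \<open>27 / (2 * \<omega>)\<close> to the
      decay rate \<open>\<omega> / 2\<close>, times 4 from the comparison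
      \<open>S t / 4 \<le> V t\<close>.\<close>
    show "\<omega> / 2 > 0" "4 * (27 / \<omega>\<^sup>2) \<ge> 0" using \<omega> by auto
    fix x y z G p q s :: "real \<Rightarrow> 'a" and M :: real
    assume dx: "\<And>t. t \<ge> 0 \<Longrightarrow> (x has_vector_derivative - G t - y t + p t) (at t within {0..})"
      and dy: "\<And>t. t \<ge> 0 \<Longrightarrow> (y has_vector_derivative - A (y t) - A (z t) + x t + q t) (at t within {0..})"
      and dz: "\<And>t. t \<ge> 0 \<Longrightarrow> (z has_vector_derivative A (y t) + s t) (at t within {0..})"
      and mono: "\<And>t. t \<ge> 0 \<Longrightarrow> \<mu> * (norm (x t))\<^sup>2 \<le> inner (x t) (G t)"
      and lip: "\<And>t. t \<ge> 0 \<Longrightarrow> norm (G t) \<le> l * norm (x t)"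
      and coer: "\<And>t. t \<ge> 0 \<Longrightarrow> c * (norm (z t))\<^sup>2 \<le> inner (z t) (A (z t))"
      and dist: "\<And>t. t \<ge> 0 \<Longrightarrow> norm (p t) \<le> M \<and> norm (q t) \<le> M \<and> norm (s t) \<le> M"
    define S where "S = (\<lambda>t. (norm (x t))\<^sup>2 + (norm (y t))\<^sup>2 + (norm (z t))\<^sup>2)"
    define V where "V = (\<lambda>t. (inner (x t) (x t) + inner (y t) (y t) + inner (z t) (z t)) / 2
      + \<epsilon> * inner (x t) (y t) + \<epsilon> * \<delta> * inner (y t) (z t))"
    define x' where "x' t = - G t - y t + p t" for t
    define y' where "y' t = - A (y t) - A (z t) + x t + q t" for t
    define z' where "z' t = A (y t) + s t" for t
    define V' where "V' = (\<lambda>t. inner (x t) (x' t) + inner (y t) (y' t) + inner (z t) (z' t)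
      + \<epsilon> * (inner (x t) (y' t) + inner (x' t) (y t))
      + \<epsilon> * \<delta> * (inner (y t) (z' t) + inner (y' t) (z t)))"
    have M: "M \<ge> 0"
      using dist[of 0] norm_ge_zero[of "p 0"] by linarith
    have inner_deriv: "((\<lambda>r. inner (v r) (w r)) has_real_derivative inner (v t) w' + inner v' (w t))
        (at t within {0..})"
      if "(v has_vector_derivative v') (at t within {0..})"
        "(w has_vector_derivative w') (at t within {0..})" for v w :: "real \<Rightarrow> 'a" and v' w' t
      using bounded_bilinear.has_vector_derivative[OF bounded_bilinear_inner that]
      by (simp add: has_real_derivative_iff_has_vector_derivative)
    have V: "(V has_real_derivative V' t) (at t within {0..})" if "t \<ge> 0" for t
    proof -
      note derivs = dx[OF that, folded x'_def] dy[OF that, folded y'_def] dz[OF that, folded z'_def]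
      have "(V has_real_derivative
          ((inner (x t) (x' t) + inner (x' t) (x t)) + (inner (y t) (y' t) + inner (y' t) (y t))
            + (inner (z t) (z' t) + inner (z' t) (z t))) / 2
          + \<epsilon> * (inner (x t) (y' t) + inner (x' t) (y t))
          + \<epsilon> * \<delta> * (inner (y t) (z' t) + inner (y' t) (z t))) (at t within {0..})"
        unfolding V_def by (intro DERIV_add DERIV_cdivide DERIV_cmult inner_deriv derivs)
      then show ?thesis
        by (simp add: V'_def inner_commute add_divide_distrib)
    qed
    have inner_le: "inner v w \<le> a * b" if "norm v \<le> a" "norm w \<le> b" for v w :: 'a and a b
      using norm_cauchy_schwarz[of v w] mult_mono[OF that] that norm_ge_zero[of v]
      by (smt (verit) norm_ge_zero)
    have inner_ge: "- (a * b) \<le> inner v w" if "norm v \<le> a" "norm w \<le> b" for v w :: 'a and a b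
      using inner_le[of "- v" a w b] that by simp
    have V'_le: "V' t \<le> - \<omega> / 2 * S t + 27 / (2 * \<omega>) * M\<^sup>2" if t: "t \<ge> 0" for t
    proof -
      let ?x = "norm (x t)" and ?y = "norm (y t)" and ?z = "norm (z t)"
      note d = dist[OF t, THEN conjunct1] dist[OF t, THEN conjunct2, THEN conjunct1]
        dist[OF t, THEN conjunct2, THEN conjunct2]
      \<comment> \<open>The coupling is skew: the products of \<open>x\<close> with \<open>y\<close>
        cancel, and by self-adjointness so do those of \<open>y\<close> with \<open>A z\<close>. The
        term \<open>- inner (y t) (A (y t))\<close> is dropped by \<open>psd\<close>.\<close>
      have energy: "inner (x t) (x' t) + inner (y t) (y' t) + inner (z t) (z' t)
          \<le> - \<mu> * ?x\<^sup>2 + M * (?x + ?y + ?z)"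
      proof -
        have "inner (x t) (x' t) + inner (y t) (y' t) + inner (z t) (z' t)
          = - inner (x t) (G t) - inner (y t) (A (y t)) + inner (x t) (p t) + inner (y t) (q t) + inner (z t) (s t)"
          using selfadjoint[of "y t" "z t"]
          by (simp add: x'_def y'_def z'_def inner_diff_right inner_add_right inner_commute)
        moreover have "inner (x t) (p t) \<le> ?x * M" "inner (y t) (q t) \<le> ?y * M" "inner (z t) (s t) \<le> ?z * M"
          by (intro inner_le d order_refl)+
        ultimately show ?thesis
          using mono[OF t] psd[of "y t"] by (simp add: algebra_simps)
      qed
      \<comment> \<open>The term \<open>- y\<close> in \<open>x'\<close> supplies the dissipation of
        the second component.\<close>
      have cross1: "inner (x t) (y' t) + inner (x' t) (y t)
        \<le> l * ?x * ?y - ?y\<^sup>2 + M * ?y + k * ?x * ?y + k * ?x * ?z + ?x\<^sup>2 + M * ?x"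
      proof -
        have "inner (x t) (y' t) + inner (x' t) (y t)
          = - inner (G t) (y t) - ?y\<^sup>2 + inner (p t) (y t) - inner (x t) (A (y t)) - inner (x t) (A (z t))
            + ?x\<^sup>2 + inner (x t) (q t)"
          by (simp add: x'_def y'_def inner_diff_right inner_add_right inner_diff_left inner_add_left
              power2_norm_eq_inner)
        moreover have "- (l * ?x * ?y) \<le> inner (G t) (y t)" "inner (p t) (y t) \<le> M * ?y"
          "- (?x * (k * ?y)) \<le> inner (x t) (A (y t))" "- (?x * (k * ?z)) \<le> inner (x t) (A (z t))"
          "inner (x t) (q t) \<le> ?x * M"
          by (intro inner_le inner_ge d lip[OF t] norm_A order_refl)+
        ultimately show ?thesis by (simp add: algebra_simps)
      qed
      \<comment> \<open>The term \<open>- A z\<close> in \<open>y'\<close> supplies, through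
        coercivity, the dissipation of the third component.\<close>
      have cross2: "inner (y t) (z' t) + inner (y' t) (z t)
        \<le> k * ?y * ?z - c * ?z\<^sup>2 + ?x * ?z + M * ?z + k * ?y\<^sup>2 + M * ?y"
      proof -
        have "inner (y t) (z' t) + inner (y' t) (z t)
          = inner (y t) (A (y t)) + inner (y t) (s t) - inner (A (y t)) (z t) - inner (z t) (A (z t))
            + inner (x t) (z t) + inner (q t) (z t)"
          by (simp add: z'_def y'_def inner_diff_right inner_add_right inner_diff_left inner_add_left
              inner_commute)
        moreover have "inner (y t) (A (y t)) \<le> ?y * (k * ?y)" "inner (y t) (s t) \<le> ?y * M"
          "- (k * ?y * ?z) \<le> inner (A (y t)) (z t)" "inner (x t) (z t) \<le> ?x * ?z"
          "inner (q t) (z t) \<le> M * ?z"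
          by (intro inner_le inner_ge d norm_A order_refl)+
        ultimately show ?thesis using coer[OF t] by (simp add: algebra_simps power2_eq_square)
      qed
      have "V' t \<le> - \<mu> * ?x\<^sup>2 + M * (?x + ?y + ?z)
        + \<epsilon> * (l * ?x * ?y - ?y\<^sup>2 + M * ?y + k * ?x * ?y + k * ?x * ?z + ?x\<^sup>2 + M * ?x)
        + \<epsilon> * \<delta> * (k * ?y * ?z - c * ?z\<^sup>2 + ?x * ?z + M * ?z + k * ?y\<^sup>2 + M * ?y)"
        unfolding V'_def using \<epsilon> \<delta> by (intro add_mono energy mult_left_mono cross1 cross2) auto
      also have "\<dots> \<le> - \<omega> / 2 * S t + 27 / (2 * \<omega>) * M\<^sup>2"
        unfolding S_def by (rule est) (use M in auto)
      finally show ?thesis .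
    qed
    \<comment> \<open>Both cross weights are at most \<open>1 / 4\<close>, so the cross terms change
      \<open>S t / 2\<close> by at most \<open>S t / 4\<close>.\<close>
    have V_S: "S t / 4 \<le> V t" "V t \<le> S t" for t
    proof -
      have cs: "\<bar>inner v w\<bar> \<le> ((norm v)\<^sup>2 + (norm w)\<^sup>2) / 2" for v w :: 'a
        using Cauchy_Schwarz_ineq2[of v w] sum_squares_bound[of "norm v" "norm w"]
        by (simp add: mult.assoc)
      have "\<bar>\<epsilon> * inner (x t) (y t)\<bar> \<le> 1 / 4 * (((norm (x t))\<^sup>2 + (norm (y t))\<^sup>2) / 2)"
        unfolding abs_mult using \<epsilon> cs by (intro mult_mono) auto
      moreover have "\<epsilon> * \<delta> \<le> 1 / 4 * 1"
        using \<epsilon> \<delta> by (intro mult_mono) auto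
      then have "\<bar>\<epsilon> * \<delta> * inner (y t) (z t)\<bar> \<le> 1 / 4 * (((norm (y t))\<^sup>2 + (norm (z t))\<^sup>2) / 2)"
        unfolding abs_mult[of "\<epsilon> * \<delta>"] using \<epsilon> \<delta> cs by (intro mult_mono) auto
      moreover have "V t = S t / 2 + \<epsilon> * inner (x t) (y t) + \<epsilon> * \<delta> * inner (y t) (z t)"
        by (simp add: V_def S_def power2_norm_eq_inner)
      moreover have "0 \<le> (norm (x t))\<^sup>2" "0 \<le> (norm (y t))\<^sup>2" "0 \<le> (norm (z t))\<^sup>2"
        by simp_all
      ultimately show "S t / 4 \<le> V t" "V t \<le> S t"
        unfolding S_def abs_le_iff by argo+
    qed
    have V'_V: "V' t \<le> - (\<omega> / 2) * V t + 27 / (2 * \<omega>) * M\<^sup>2" if "t \<ge> 0" for t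
    proof -
      have "\<omega> / 2 * V t \<le> \<omega> / 2 * S t"
        using V_S \<omega> by (intro mult_left_mono) auto
      then show ?thesis using V'_le[OF that] by simp
    qed
    have "(norm (x t))\<^sup>2 \<le> (4 * (V 0 - 27 / \<omega>\<^sup>2 * M\<^sup>2)) * exp (- (\<omega> / 2) * t) + 4 * (27 / \<omega>\<^sup>2) * M\<^sup>2"
      if t: "t \<ge> 0" for t
    proof -
      have C: "27 / (2 * \<omega>) * M\<^sup>2 / (\<omega> / 2) = 27 / \<omega>\<^sup>2 * M\<^sup>2"
        using \<omega> by (simp add: power2_eq_square)
      have "V t \<le> (V 0 - 27 / \<omega>\<^sup>2 * M\<^sup>2) * exp (- (\<omega> / 2) * t) + 27 / \<omega>\<^sup>2 * M\<^sup>2"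
        using differential_inequality_exp_bound[OF V V'_V, of t] \<omega> t
        unfolding C by simp
      moreover have "(norm (x t))\<^sup>2 \<le> 4 * V t"
        using V_S(1)[of t] zero_le_power2[of "norm (y t)"] zero_le_power2[of "norm (z t)"]
        unfolding S_def by argo
      ultimately show ?thesis
        by (simp only: mult.assoc)
    qed
    then show "\<exists>B. \<forall>t\<ge>0. (norm (x t))\<^sup>2 \<le> B * exp (- (\<omega> / 2) * t) + 4 * (27 / \<omega>\<^sup>2) * M\<^sup>2"
      by blast
  qed
qed

section \<open>The weighted graph Laplacian\<close>

text \<open>For \<open>real ^ 'n\<close> components this is the Laplacian matrix tensored with the
  identity, kept in the difference form in which it occurs in the algorithm.\<close>

definition graph_laplacian :: "('m \<Rightarrow> 'm \<Rightarrow> real) \<Rightarrow> 'a::real_vector ^ 'm::finite \<Rightarrow> 'a ^ 'm" where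
  "graph_laplacian a v = (\<chi> i. \<Sum>j\<in>UNIV. a i j *\<^sub>R (v $ i - v $ j))"

lemma graph_laplacian_nth [simp]:
  "graph_laplacian a v $ i = (\<Sum>j\<in>UNIV. a i j *\<^sub>R (v $ i - v $ j))"
  by (simp add: graph_laplacian_def)

lemma linear_graph_laplacian: "linear (graph_laplacian a)"
  by (rule linearI)
    (simp_all add: vec_eq_iff algebra_simps sum.distrib sum_subtractf scaleR_sum_right)

lemma graph_laplacian_consensus: "graph_laplacian a (\<chi> i. c) = 0"
  by (simp add: vec_eq_iff)

text \<open>Exchanging the roles of \<open>i\<close> and \<open>j\<close> in the double sum and
  averaging the two versions gives the Dirichlet form, from which symmetry and positivity can be
  read off.\<close>

lemma inner_graph_laplacian:
  fixes v w :: "'a::real_inner ^ 'm::finite"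
  assumes sym: "\<And>i j. a i j = a j i"
  shows "inner w (graph_laplacian a v) =
    (\<Sum>i\<in>UNIV. \<Sum>j\<in>UNIV. a i j * inner (w $ i - w $ j) (v $ i - v $ j)) / 2"
proof -
  let ?s = "\<Sum>i\<in>UNIV. \<Sum>j\<in>UNIV. a i j * inner (w $ i) (v $ i - v $ j)"
  have "?s = (\<Sum>j\<in>UNIV. \<Sum>i\<in>UNIV. a i j * inner (w $ i) (v $ i - v $ j))"
    by (rule sum.swap)
  also have "\<dots> = (\<Sum>i\<in>UNIV. \<Sum>j\<in>UNIV. a i j * inner (w $ j) (v $ j - v $ i))"
    using sym by simp
  finally have "?s + ?s = (\<Sum>i\<in>UNIV. \<Sum>j\<in>UNIV.
      a i j * inner (w $ i) (v $ i - v $ j) + a i j * inner (w $ j) (v $ j - v $ i))"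
    by (simp add: sum.distrib)
  also have "\<dots> = (\<Sum>i\<in>UNIV. \<Sum>j\<in>UNIV. a i j * inner (w $ i - w $ j) (v $ i - v $ j))"
    by (simp add: algebra_simps)
  finally show ?thesis
    by (simp add: inner_vec_def inner_sum_right)
qed

lemma graph_laplacian_selfadjoint:
  fixes v w :: "'a::real_inner ^ 'm::finite"
  assumes "\<And>i j. a i j = a j i"
  shows "inner (graph_laplacian a v) w = inner v (graph_laplacian a w)"
  using inner_graph_laplacian[of a w v] inner_graph_laplacian[of a v w] assms
  by (simp add: inner_commute)

lemma graph_laplacian_psd:
  fixes v :: "'a::real_inner ^ 'm::finite"
  assumes "\<And>i j. a i j = a j i" and "\<And>i j. 0 \<le> a i j"
  shows "0 \<le> inner v (graph_laplacian a v)"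
  using assms by (simp add: inner_graph_laplacian sum_nonneg)

text \<open>Test the Laplacian against the consensus vector whose entries all equal the sum
  \<open>?s\<close>; self-adjointness moves it onto that vector, which it annihilates.\<close>

lemma sum_graph_laplacian:
  fixes v :: "'a::real_inner ^ 'm::finite"
  assumes "\<And>i j. a i j = a j i"
  shows "(\<Sum>i\<in>UNIV. graph_laplacian a v $ i) = 0"
proof -
  let ?s = "\<Sum>i\<in>UNIV. graph_laplacian a v $ i"
  have "inner ?s ?s = inner (\<chi> i. ?s) (graph_laplacian a v)"
    unfolding inner_vec_def by (simp only: vec_lambda_beta inner_sum_right)
  also have "\<dots> = inner (graph_laplacian a (\<chi> i. ?s)) v"
    by (rule graph_laplacian_selfadjoint[symmetric]) (rule assms)
  finally show ?thesis
    by (simp only: graph_laplacian_consensus inner_zero_left inner_eq_zero_iff)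
qed

text \<open>If both nonnegative terms vanish, the Dirichlet form makes \<open>v\<close> constant
  along edges, connectivity makes it constant altogether, and a constant vector with zero sum is
  0.\<close>

lemma graph_laplacian_plus_sum_pos_definite:
  fixes v :: "'a::real_inner ^ 'm::finite"
  assumes graph: "undirected_connected E" and weights: "symmetric_edge_weights E a"
    and "v \<noteq> 0"
  shows "0 < inner v (graph_laplacian a v) + (norm (\<Sum>i\<in>UNIV. v $ i))\<^sup>2"
proof (rule ccontr)
  assume "\<not> ?thesis"
  have a: "\<And>i j. a i j = a j i" "\<And>i j. 0 \<le> a i j" "\<And>i j. (i, j) \<in> E \<Longrightarrow> 0 < a i j"
    using weights by (auto simp: symmetric_edge_weights_def)
  have "0 \<le> inner v (graph_laplacian a v)"
    using a by (intro graph_laplacian_psd)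
  with \<open>\<not> ?thesis\<close> have zero: "inner v (graph_laplacian a v) = 0" and "(norm (\<Sum>i\<in>UNIV. v $ i))\<^sup>2 = 0"
    using zero_le_power2[of "norm (\<Sum>i\<in>UNIV. v $ i)"] by linarith+
  then have sum0: "(\<Sum>i\<in>UNIV. v $ i) = 0" by simp
  have "(\<Sum>i\<in>UNIV. \<Sum>j\<in>UNIV. a i j * inner (v $ i - v $ j) (v $ i - v $ j)) = 0"
    using zero inner_graph_laplacian[of a v v] a(1) by simp
  then have "a i j * inner (v $ i - v $ j) (v $ i - v $ j) = 0" for i j
    using a(2) by (simp add: sum_nonneg_eq_0_iff sum_nonneg)
  then have edge: "v $ i = v $ j" if "(i, j) \<in> E" for i j
    using a(3)[OF that] by (metis inner_eq_zero_iff less_irrefl mult_eq_0_iff right_minus_eq)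
  have consensus: "v $ i = v $ j" for i j
  proof -
    have "(i, j) \<in> E\<^sup>*"
      using graph by (simp add: undirected_connected_def)
    then show ?thesis
      by induction (auto dest: edge)
  qed
  have "v $ i = 0" for i
  proof -
    have "(\<Sum>j\<in>UNIV. v $ j) = (\<Sum>j\<in>(UNIV :: 'm set). v $ i)"
      using consensus by (intro sum.cong) auto
    with sum0 show ?thesis by (simp add: sum_constant_scaleR)
  qed
  with \<open>v \<noteq> 0\<close> show False by (simp add: vec_eq_iff)
qed

text \<open>The form \<open>Q\<close> is positive on the whole unit sphere, so by compactness it has
  a positive minimum there, and quadratic scaling extends the bound to all vectors. On vectors with
  zero sum \<open>Q\<close> is the Laplacian form.\<close>

lemma graph_laplacian_coercive:
  fixes E :: "('m::finite \<times> 'm) set"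
  assumes "undirected_connected E" and "symmetric_edge_weights E a"
  obtains c where "c > 0" and "\<And>v :: 'a::euclidean_space ^ 'm. (\<Sum>i\<in>UNIV. v $ i) = 0 \<Longrightarrow>
    c * (norm v)\<^sup>2 \<le> inner v (graph_laplacian a v)"
proof -
  define Q where "Q = (\<lambda>v :: 'a ^ 'm. inner v (graph_laplacian a v) + (norm (\<Sum>i\<in>UNIV. v $ i))\<^sup>2)"
  have lap: "bounded_linear (graph_laplacian a :: 'a ^ 'm \<Rightarrow> _)"
    using linear_graph_laplacian linear_conv_bounded_linear by blast
  have "continuous_on (sphere 0 1) Q"
    unfolding Q_def by (intro continuous_intros bounded_linear.continuous_on[OF lap])
  moreover have "(SOME b. b \<in> Basis) \<in> sphere (0 :: 'a ^ 'm) 1"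
    by (simp add: SOME_Basis)
  then have "sphere (0 :: 'a ^ 'm) 1 \<noteq> {}" by blast
  ultimately obtain u where u: "norm u = 1" and min: "\<And>v. norm v = 1 \<Longrightarrow> Q u \<le> Q v"
    using continuous_attains_inf[OF compact_sphere, of 0 1 Q] by auto
  show ?thesis
  proof
    show "Q u > 0"
      unfolding Q_def using graph_laplacian_plus_sum_pos_definite[OF assms, of u] u by force
    fix v :: "'a ^ 'm"
    assume "(\<Sum>i\<in>UNIV. v $ i) = 0"
    then have Q: "Q v = inner v (graph_laplacian a v)"
      by (simp add: Q_def)
    show "Q u * (norm v)\<^sup>2 \<le> inner v (graph_laplacian a v)"
    proof (cases "v = 0")
      case False
      have "Q (r *\<^sub>R v) = r\<^sup>2 * Q v" for r
        by (simp add: Q_def linear_scale[OF linear_graph_laplacian] scaleR_sum_right[symmetric]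
            power2_eq_square algebra_simps)
      with min[of "inverse (norm v) *\<^sub>R v"] False have "Q u \<le> (inverse (norm v))\<^sup>2 * Q v"
        by simp
      with False show ?thesis
        unfolding Q[symmetric] by (simp add: field_simps)
    qed simp
  qed
qed

text \<open>Adding the sum to every component turns the Laplacian into a positive definite, hence
  surjective, operator that agrees with it on vectors with zero sum.\<close>

lemma graph_laplacian_solvable:
  fixes b :: "'a::euclidean_space ^ 'm::finite"
  assumes graph: "undirected_connected E" and weights: "symmetric_edge_weights E a"
    and b: "(\<Sum>i\<in>UNIV. b $ i) = 0"
  obtains v where "graph_laplacian a v = b"
proof -
  define B where "B = (\<lambda>v :: 'a ^ 'm. graph_laplacian a v + (\<chi> i. \<Sum>j\<in>UNIV. v $ j))"
  have "linear (\<lambda>v :: 'a ^ 'm. (\<chi> i. \<Sum>j\<in>UNIV. v $ j) :: 'a ^ 'm)"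
    by (rule linearI) (simp_all add: vec_eq_iff sum.distrib scaleR_sum_right)
  then have lin: "linear B"
    unfolding B_def by (intro linear_compose_add linear_graph_laplacian)
  have "inner v (\<chi> i. \<Sum>j\<in>UNIV. v $ j) = (norm (\<Sum>i\<in>UNIV. v $ i))\<^sup>2" for v :: "'a ^ 'm"
    by (simp add: inner_vec_def power2_norm_eq_inner flip: inner_sum_left)
  then have "B v \<noteq> 0" if "v \<noteq> 0" for v
    using graph_laplacian_plus_sum_pos_definite[OF graph weights that]
    by (metis B_def inner_add_right inner_zero_right less_irrefl)
  then have "inj B"
    by (metis linear_injective_0[OF lin])
  then have "surj B"
    using linear_injective_imp_surjective[OF lin] by blast
  then obtain v where v: "B v = b"
    by (metis surjD)
  \<comment> \<open>Summing the components of \<open>B v = b\<close> removes the Laplacian part, so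
    the zero sum of \<open>b\<close> passes to \<open>v\<close> and the added term of
    \<open>B\<close> vanishes.\<close>
  have "(\<Sum>i\<in>UNIV. B v $ i) = (\<Sum>i\<in>UNIV. graph_laplacian a v $ i) + (\<Sum>i\<in>(UNIV :: 'm set). \<Sum>j\<in>UNIV. v $ j)"
    unfolding B_def by (simp only: vector_add_component vec_lambda_beta sum.distrib)
  also have "\<dots> = real CARD('m) *\<^sub>R (\<Sum>j\<in>UNIV. v $ j)"
    using weights by (simp add: sum_graph_laplacian symmetric_edge_weights_def sum_constant_scaleR
        del: graph_laplacian_nth)
  finally have "(\<Sum>j\<in>UNIV. v $ j) = 0"
    using v b by simp
  with v have "graph_laplacian a v = b"
    by (simp add: B_def vec_eq_iff)
  then show ?thesis ..
qed

section \<open>Derivatives and norms of stacked vectors\<close>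

text \<open>A stacked vector is the finite sum of its components under the bounded linear embeddings
  \<open>axis i\<close>.\<close>

lemma has_vector_derivative_vec:
  fixes x :: "real \<Rightarrow> 'a::euclidean_space ^ 'm::finite"
  assumes "\<And>i. ((\<lambda>s. x s $ i) has_vector_derivative x' $ i) F"
  shows "(x has_vector_derivative x') F"
proof -
  have axis: "bounded_linear (axis i :: 'a \<Rightarrow> 'a ^ 'm)" for i
    by (intro linear_conv_bounded_linear[THEN iffD1] linearI) (simp_all add: axis_def vec_eq_iff)
  have expand: "v = (\<Sum>i\<in>UNIV. axis i (v $ i))" for v :: "'a ^ 'm"
    by (simp add: vec_eq_iff axis_def)
  have "((\<lambda>s. \<Sum>i\<in>UNIV. axis i (x s $ i)) has_vector_derivative (\<Sum>i\<in>UNIV. axis i (x' $ i))) F"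
    by (intro has_vector_derivative_sum bounded_linear.has_vector_derivative[OF axis] assms)
  then show ?thesis
    unfolding expand[symmetric] .
qed

lemma norm_vec_le_card:
  fixes v :: "'a::real_normed_vector ^ 'm::finite"
  assumes "\<And>i. norm (v $ i) \<le> D"
  shows "norm v \<le> real CARD('m) * D"
proof -
  have "norm v \<le> (\<Sum>i\<in>UNIV. norm (v $ i))"
    unfolding norm_vec_def by (rule L2_set_le_sum) simp
  also have "\<dots> \<le> real CARD('m) * D"
    using sum_bounded_above[of UNIV "\<lambda>i. norm (v $ i)" D] assms by simp
  finally show ?thesis .
qed

section \<open>Error dynamics and the asymptotic bound\<close>

theorem theorem1:
  fixes f :: "'m::finite \<Rightarrow> real ^ 'n::finite \<Rightarrow> real"
    and grad_f :: "'m \<Rightarrow> real ^ 'n \<Rightarrow> real ^ 'n"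
    and d :: "'m \<Rightarrow> real ^ 'n"
    and E :: "('m \<times> 'm) set"
    and a :: "'m \<Rightarrow> 'm \<Rightarrow> real"
    and l :: real
    and Xopt :: "(real ^ 'n) ^ 'm"
  assumes graph: "undirected_connected E"
    and weights: "symmetric_edge_weights E a"
    and C1: "\<And>i. continuously_differentiable_with_gradient (f i) (grad_f i)"
    and strongly_convex: "\<And>i. strongly_convex (f i)"
    and lipschitz: "\<And>i. l-lipschitz_on UNIV (grad_f i)"
    and optimal: "optimal_allocation f d Xopt"
  shows "\<exists>r :: real \<Rightarrow> real. (\<forall>D\<ge>0. 0 \<le> r D) \<and>
    (\<forall>(D::real) (ua :: real \<Rightarrow> (real ^ 'n) ^ 'm) (la :: real \<Rightarrow> (real ^ 'n) ^ 'm) (za :: real \<Rightarrow> (real ^ 'n) ^ 'm)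
       (X :: real \<Rightarrow> (real ^ 'n) ^ 'm) (L :: real \<Rightarrow> (real ^ 'n) ^ 'm) (Z :: real \<Rightarrow> (real ^ 'n) ^ 'm).
       (\<forall>i. bounded_signal (\<lambda>t. ua t $ i) \<and> bounded_signal (\<lambda>t. la t $ i) \<and> bounded_signal (\<lambda>t. za t $ i)) \<longrightarrow>
       (\<forall>i. \<forall>t\<ge>0. norm (ua t $ i) \<le> D \<and> norm (la t $ i) \<le> D \<and> norm (za t $ i) \<le> D) \<longrightarrow>
       attacked_solution grad_f d a ua la za X L Z \<longrightarrow>
       Limsup at_top (\<lambda>t. ereal (norm (X t - Xopt))) \<le> ereal (r D))"
proof -
  have a_sym: "a i j = a j i" and a_nn: "0 \<le> a i j" for i j
    using weights by (auto simp: symmetric_edge_weights_def)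
  have grad: "GDERIV (f i) x :> grad_f i x" for i x
    using C1 by (simp add: continuously_differentiable_with_gradient_def)
  have "\<exists>\<mu>>0. \<forall>x y. \<mu> * (norm (x - y))\<^sup>2 \<le> inner (x - y) (grad_f i x - grad_f i y)" for i
    by (rule strongly_convex_gradient_strongly_monotone[OF strongly_convex grad])
  then obtain \<mu>i where \<mu>i: "\<And>i. \<mu>i i > 0"
    "\<And>i x y. \<mu>i i * (norm (x - y))\<^sup>2 \<le> inner (x - y) (grad_f i x - grad_f i y)"
    by metis
  \<comment> \<open>There are finitely many agents, so the smallest modulus is positive and serves
    all of them.\<close>
  define \<mu> where "\<mu> = Min (range \<mu>i)"
  have \<mu>: "\<mu> > 0" "\<mu> \<le> \<mu>i i" for i
    using \<mu>i(1) by (auto simp: \<mu>_def)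
  have l: "l \<ge> 0"
    using lipschitz lipschitz_on_nonneg by blast
  let ?A = "graph_laplacian a :: (real ^ 'n) ^ 'm \<Rightarrow> _"
  note lin = linear_graph_laplacian[of a, where 'a = "real ^ 'n"]
  obtain k where k: "k \<ge> 0" "\<And>v. norm (?A v) \<le> k * norm v"
    using lin bounded_linear.nonneg_bounded linear_conv_bounded_linear by (metis mult.commute)
  obtain c where c: "c > 0" and coercive: "\<And>v :: (real ^ 'n) ^ 'm. (\<Sum>i\<in>UNIV. v $ i) = 0 \<Longrightarrow>
      c * (norm v)\<^sup>2 \<le> inner v (?A v)"
    using graph_laplacian_coercive[OF graph weights] by metis
  have selfadjoint: "inner (?A v) w = inner v (?A w)" for v w
    by (rule graph_laplacian_selfadjoint) (rule a_sym)
  have psd: "0 \<le> inner v (?A v)" for v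
    by (rule graph_laplacian_psd) (rule a_sym a_nn)+
  \<comment> \<open>Feasibility is exactly the solvability condition for a \<open>Zopt\<close> that
    balances the \<lambda> equation at \<open>Xopt\<close> when all multipliers agree.\<close>
  have "(\<Sum>i\<in>UNIV. (Xopt - (\<chi> i. d i)) $ i) = 0"
    using optimal by (simp add: optimal_allocation_def feasible_allocation_def sum_subtractf)
  then obtain Zopt where Zopt: "?A Zopt = Xopt - (\<chi> i. d i)"
    using graph_laplacian_solvable[OF graph weights] by metis
  \<comment> \<open>The common KKT multiplier; \<open>undefined\<close> is merely some agent, and
    any other gives the same value.\<close>
  define \<nu> where "\<nu> = - grad_f undefined (Xopt $ undefined)"
  have grad_Xopt: "grad_f i (Xopt $ i) = - \<nu>" for i
    unfolding \<nu>_def using optimal_allocation_gradients_eq[OF optimal grad] by auto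
  \<comment> \<open>Subtracting the average projects onto the vectors with zero sum, where the
    Laplacian is coercive.\<close>
  define P :: "(real ^ 'n) ^ 'm \<Rightarrow> (real ^ 'n) ^ 'm"
    where "P v = v - (\<chi> i. (1 / real CARD('m)) *\<^sub>R (\<Sum>j\<in>UNIV. v $ j))" for v
  have "linear P"
    unfolding P_def
    by (rule linearI) (simp_all add: vec_eq_iff sum.distrib scaleR_sum_right algebra_simps)
  then have P: "bounded_linear P"
    by (simp add: linear_conv_bounded_linear)
  have sum_P: "(\<Sum>i\<in>UNIV. P v $ i) = 0" for v
    by (simp add: P_def sum_subtractf sum_constant_scaleR del: sum_constant)
  have A_P: "?A (P v) = ?A v" for v
    unfolding P_def linear_diff[OF lin] graph_laplacian_consensus by simp
  have P_A: "P (?A v) = ?A v" for v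
    using sum_graph_laplacian[of a v, OF a_sym] by (simp add: P_def vec_eq_iff del: graph_laplacian_nth)
  \<comment> \<open>One bound for all three disturbances: a stacked attack has norm at most
    \<open>real CARD('m) * D\<close>, and \<open>?A\<close> enlarges it by at most \<open>k\<close>,
    twice in the \<lambda> equation.\<close>
  define m where "m D = (1 + 2 * k) * (real CARD('m) * D)" for D
  show ?thesis
  proof (rule perturbed_saddle_flow_bound[OF \<mu>(1) c l k(1) selfadjoint psd k(2)])
    fix \<alpha> K :: real
    assume \<alpha>: "\<alpha> > 0" and K: "K \<ge> 0"
      and bound: "\<And>x y z G p q s M. \<lbrakk>
        \<And>t. t \<ge> 0 \<Longrightarrow> (x has_vector_derivative - G t - y t + p t) (at t within {0..});
        \<And>t. t \<ge> 0 \<Longrightarrow> (y has_vector_derivative - ?A (y t) - ?A (z t) + x t + q t) (at t within {0..});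
        \<And>t. t \<ge> 0 \<Longrightarrow> (z has_vector_derivative ?A (y t) + s t) (at t within {0..});
        \<And>t. t \<ge> 0 \<Longrightarrow> \<mu> * (norm (x t))\<^sup>2 \<le> inner (x t) (G t);
        \<And>t. t \<ge> 0 \<Longrightarrow> norm (G t) \<le> l * norm (x t);
        \<And>t. t \<ge> 0 \<Longrightarrow> c * (norm (z t))\<^sup>2 \<le> inner (z t) (?A (z t));
        \<And>t. t \<ge> 0 \<Longrightarrow> norm (p t) \<le> M \<and> norm (q t) \<le> M \<and> norm (s t) \<le> M\<rbrakk> \<Longrightarrow>
        \<exists>B. \<forall>t\<ge>0. (norm (x t))\<^sup>2 \<le> B * exp (- \<alpha> * t) + K * M\<^sup>2"
    show ?thesis
    \<comment> \<open>\<open>K\<close> and \<open>m\<close> are fixed before any attack or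
      trajectory is introduced, so the radius depends on the problem data and \<open>D\<close>
      only.\<close>
    proof (intro exI[of _ "\<lambda>D. sqrt (K * (m D)\<^sup>2)"] conjI allI impI)
      fix D :: real
      show "0 \<le> sqrt (K * (m D)\<^sup>2)" using K by simp
    next
      fix D :: real and ua la za X L Z :: "real \<Rightarrow> (real ^ 'n) ^ 'm"
      assume attack: "\<forall>i. \<forall>t\<ge>0. norm (ua t $ i) \<le> D \<and> norm (la t $ i) \<le> D \<and> norm (za t $ i) \<le> D"
        and sol: "attacked_solution grad_f d a ua la za X L Z"
      define x where "x t = X t - Xopt" for t
      define y where "y t = L t - (\<chi> i. \<nu>)" for t
      define z where "z t = P (Z t - Zopt)" for t
      \<comment> \<open>The gradient at \<open>Xopt\<close> contributes \<open>- \<nu>\<close>,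
        which offsets the shift in \<open>y\<close>; hence \<open>- G - y\<close> is the nominal
        right-hand side for \<open>X\<close>.\<close>
      define G where "G t = (\<chi> i. grad_f i (X t $ i) - grad_f i (Xopt $ i))" for t
      \<comment> \<open>Exchanged false data enter through \<open>?A\<close>: \<open>q\<close> and
        \<open>s\<close> are the stacked \<open>kappa2\<close> and \<open>kappa3\<close>.\<close>
      define q where "q t = - ?A (la t) - ?A (za t)" for t
      define s where "s t = ?A (la t)" for t
      have A_y: "?A (y t) = ?A (L t)" for t
        unfolding y_def linear_diff[OF lin] graph_laplacian_consensus by simp
      have A_z: "?A (z t) = ?A (Z t) - Xopt + (\<chi> i. d i)" for t
        unfolding z_def A_P linear_diff[OF lin] Zopt by simp
      have "\<exists>B. \<forall>t\<ge>0. (norm (x t))\<^sup>2 \<le> B * exp (- \<alpha> * t) + K * (m D)\<^sup>2"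
      proof (rule bound[of x G y ua z q s])
        fix t :: real
        assume t: "t \<ge> 0"
        note sol_t = sol[unfolded attacked_solution_def kappa1_def kappa2_def kappa3_def, rule_format, OF t]
        have "(X has_vector_derivative - G t - y t + ua t) (at t within {0..})"
        proof (rule has_vector_derivative_vec)
          fix i
          show "((\<lambda>s. X s $ i) has_vector_derivative (- G t - y t + ua t) $ i) (at t within {0..})"
            using sol_t[of i, THEN conjunct1] by (simp add: G_def y_def grad_Xopt algebra_simps)
        qed
        then show "(x has_vector_derivative - G t - y t + ua t) (at t within {0..})"
          unfolding x_def by (auto intro!: derivative_eq_intros)
        have "(L has_vector_derivative - ?A (y t) - ?A (z t) + x t + q t) (at t within {0..})"
        proof (rule has_vector_derivative_vec)
          fix i
          have "(- ?A (y t) - ?A (z t) + x t + q t) $ i =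
              - (?A (L t) $ i) - (?A (Z t) $ i) + X t $ i - d i + (- (?A (la t) $ i) - (?A (za t) $ i))"
            by (simp add: A_y A_z x_def q_def del: graph_laplacian_nth)
          with sol_t[of i, THEN conjunct2, THEN conjunct1]
          show "((\<lambda>s. L s $ i) has_vector_derivative (- ?A (y t) - ?A (z t) + x t + q t) $ i)
              (at t within {0..})"
            by (simp only: graph_laplacian_nth)
        qed
        then show "(y has_vector_derivative - ?A (y t) - ?A (z t) + x t + q t) (at t within {0..})"
          unfolding y_def by (auto intro!: derivative_eq_intros)
        have Z: "(Z has_vector_derivative ?A (y t) + s t) (at t within {0..})"
        proof (rule has_vector_derivative_vec)
          fix i
          show "((\<lambda>s. Z s $ i) has_vector_derivative (?A (y t) + s t) $ i) (at t within {0..})"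
            using sol_t[of i, THEN conjunct2, THEN conjunct2] by (simp add: A_y s_def)
        qed
        \<comment> \<open>\<open>P\<close> leaves the derivative unchanged because both of its terms
          lie in the range of \<open>?A\<close>.\<close>
        have "((\<lambda>t. P (Z t - Zopt)) has_vector_derivative P (?A (y t) + s t - 0)) (at t within {0..})"
          by (intro bounded_linear.has_vector_derivative[OF P] has_vector_derivative_diff Z
              has_vector_derivative_const)
        moreover have "P (?A (y t) + s t - 0) = ?A (y t) + s t"
          by (simp add: s_def P_A bounded_linear.linear[OF P, THEN linear_add])
        ultimately show "(z has_vector_derivative ?A (y t) + s t) (at t within {0..})"
          unfolding z_def by simp
        have "\<mu> * (norm (x t))\<^sup>2 = (\<Sum>i\<in>UNIV. \<mu> * (norm (X t $ i - Xopt $ i))\<^sup>2)"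
          by (simp add: x_def power2_norm_eq_inner inner_vec_def sum_distrib_left)
        also have "\<dots> \<le> (\<Sum>i\<in>UNIV. inner (X t $ i - Xopt $ i) (grad_f i (X t $ i) - grad_f i (Xopt $ i)))"
          by (intro sum_mono order_trans[OF mult_right_mono[OF \<mu>(2)] \<mu>i(2)]) simp
        also have "\<dots> = inner (x t) (G t)"
          by (simp add: x_def G_def inner_vec_def)
        finally show "\<mu> * (norm (x t))\<^sup>2 \<le> inner (x t) (G t)" .
        have "norm (G t $ i) \<le> l * norm (x t $ i)" for i
          using lipschitz_onD[OF lipschitz, of "X t $ i" "Xopt $ i"]
          by (simp add: G_def x_def dist_norm)
        then have "norm (G t) \<le> L2_set (\<lambda>i. l * norm (x t $ i)) UNIV"
          unfolding norm_vec_def by (intro L2_set_mono) auto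
        then show "norm (G t) \<le> l * norm (x t)"
          using l by (simp add: norm_vec_def L2_set_right_distrib)
        show "c * (norm (z t))\<^sup>2 \<le> inner (z t) (?A (z t))"
          unfolding z_def by (rule coercive[OF sum_P])
        have attack_norms: "norm (ua t) \<le> real CARD('m) * D" "norm (la t) \<le> real CARD('m) * D"
          "norm (za t) \<le> real CARD('m) * D"
          using attack t by (simp_all add: norm_vec_le_card)
        then have A_attack: "norm (?A (la t)) \<le> k * (real CARD('m) * D)"
            "norm (?A (za t)) \<le> k * (real CARD('m) * D)"
          by (meson k order_trans mult_left_mono)+
        have "0 \<le> real CARD('m) * D"
          using attack_norms(1) norm_ge_zero order_trans by blast
        moreover from this have "0 \<le> k * (real CARD('m) * D)"
          using k(1) by simp
        moreover have "norm (q t) \<le> norm (?A (la t)) + norm (?A (za t))"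
          unfolding q_def using norm_triangle_ineq4[of "- ?A (la t)" "?A (za t)"] by simp
        moreover have "m D = real CARD('m) * D + 2 * (k * (real CARD('m) * D))"
          by (simp add: m_def algebra_simps)
        ultimately show "norm (ua t) \<le> m D \<and> norm (q t) \<le> m D \<and> norm (s t) \<le> m D"
          using attack_norms(1) A_attack unfolding s_def by linarith
      qed
      then obtain B where B: "\<And>t. t \<ge> 0 \<Longrightarrow> (norm (x t))\<^sup>2 \<le> B * exp (- \<alpha> * t) + K * (m D)\<^sup>2"
        by blast
      \<comment> \<open>\<open>B\<close> may depend on the trajectory, but its factor decays, so it
        disappears from the upper limit.\<close>
      have "((\<lambda>t. exp (- \<alpha> * t)) \<longlongrightarrow> 0) at_top"
        using \<alpha> by (intro filterlim_compose[OF exp_at_bot] filterlim_tendsto_neg_mult_at_bot[OF tendsto_const]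
            filterlim_ident) simp
      then have "((\<lambda>t. sqrt (B * exp (- \<alpha> * t) + K * (m D)\<^sup>2)) \<longlongrightarrow> sqrt (B * 0 + K * (m D)\<^sup>2)) at_top"
        by (intro tendsto_intros)
      then have lim: "((\<lambda>t. ereal (sqrt (B * exp (- \<alpha> * t) + K * (m D)\<^sup>2))) \<longlongrightarrow> ereal (sqrt (K * (m D)\<^sup>2))) at_top"
        by simp
      have "\<forall>\<^sub>F t in at_top. ereal (norm (X t - Xopt)) \<le> ereal (sqrt (B * exp (- \<alpha> * t) + K * (m D)\<^sup>2))"
        using eventually_ge_at_top[of 0]
        by eventually_elim (use B in \<open>auto simp: x_def intro: real_le_rsqrt\<close>)
      then have "Limsup at_top (\<lambda>t. ereal (norm (X t - Xopt))) \<le>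
          Limsup at_top (\<lambda>t. ereal (sqrt (B * exp (- \<alpha> * t) + K * (m D)\<^sup>2)))"
        by (rule Limsup_mono)
      also have "\<dots> = ereal (sqrt (K * (m D)\<^sup>2))"
        by (rule lim_imp_Limsup[OF _ lim]) simp
      finally show "Limsup at_top (\<lambda>t. ereal (norm (X t - Xopt))) \<le> ereal (sqrt (K * (m D)\<^sup>2))" .
    qed
  qed
qed

end
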